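(* Let $V$ be a finite-dimensional inner product space. The assignment $\mathfrak{F} \mapsto \mathsf{OI}(\mathfrak{F})$ (acting on morphisms by sending a Galois connection to itself) is a functor $\mathsf{OI} : \mathsf{Mon}(V) \to \mathsf{DT\text{-}Fnc}(V)$. Moreover, for any two objects $\mathfrak{F}$ and $\mathfrak{G}$ of $\mathsf{Mon}(V)$, $$d^E_{\mathsf{DT\text{-}Fnc}(V)}\big(\mathsf{OI}(\mathfrak{F}), \mathsf{OI}(\mathfrak{G})\big) \le d^E_{\mathsf{Mon}(V)}(\mathfrak{F},\mathfrak{G}).$$
   Context: Grassmannian: $\mathsf{Gr}(V)$ is the set of all linear subspaces of $V$, a commutative monoid under sum of subspaces (identity $\{0\}$) and a poset under inclusion. For subspaces $W_1,W_2\subseteq V$, $W_1\ominus W_2 := W_1\cap W_2^\perp$. Monotone space function: an order-preserving function $\mathfrak{F} : R \to \mathsf{Gr}(V)$ with $R$ a finite poset. Its Orthogonal Inverse is $\mathsf{OI}(\mathfrak{F}) : R \to \mathsf{Gr}(V)$, $\mathsf{OI}(\mathfrak{F})(r) := \mathfrak{F}(r)\ominus \big(\sum_{r'<r}\mathfrak{F}(r')\big)$ (empty sum is $\{0\}$). Downward transversal function: a function $\mathfrak{M} : R \to \mathsf{Gr}(V)$, $R$ a finite poset, such that for every $r\in R$, $\dim\big(\mathfrak{M}(r)+\sum_{r'<r}\mathfrak{M}(r')\big) = \dim \mathfrak{M}(r) + \dim \sum_{r'<r}\mathfrak{M}(r')$. Möbius equivalence: for $m_1,m_2 : R \to \mathsf{Gr}(V)$,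 $m_1\simeq m_2$ means $\sum_{r'\le r}m_1(r')=\sum_{r'\le r}m_2(r')$ for all $r\in R$. Finite metric poset: a finite poset $P$ with an (extended, i.e. possibly $\infty$-valued) metric $d_P$ such that for all $p_1\le p_2\le p_3$, $d_P(p_1,p_2)\le d_P(p_1,p_3)$ and $d_P(p_2,p_3)\le d_P(p_1,p_3)$. The distortion of an order-preserving map $\alpha : P \to Q$ of finite metric posets is $\mathrm{dis}(\alpha) := \max_{p_1,p_2\in P}|d_P(p_1,p_2)-d_Q(\alpha(p_1),\alpha(p_2))| \in [0,\infty]$, with the convention $|\infty-\infty|=0$. Galois connection $f_\diamond : R\leftrightarrows S : f^\diamond$: order-preserving maps $f_\diamond : R\to S$, $f^\diamond : S \to R$ with $f_\diamond(r)\le s\iff r\le f^\diamond(s)$. Galois connections compose via $(g_\diamond\circ f_\diamond,\ f^\diamond\circ g^\diamond)$. Pushforward: $((f_\diamond)_\sharp\mathfrak{M})(s) := \sum_{r\in f_\diamond^{-1}(s)}\mathfrak{M}(r)$. Category $\mathsf{Mon}(V)$: objects are monotone space functions defined over finite metric posets; a morphism from $\mathfrak{F}:R\to\mathsf{Gr}(V)$ to $\mathfrak{G}:S\to\mathsf{Gr}(V)$ is a Galois connection $f_\diamond : R\leftrightarrows S : f^\diamond$ with $\mathfrak{F}\circ f^\diamond=\mathfrak{G}$; its cost is $\mathrm{dis}(f_\diamond)$. Category $\mathsf{DT\text{-}Fnc}(V)$: objects are downward transversal functions defined over finite metric posets; a morphism from $\mathfrak{M}:R\to\mathsf{Gr}(V)$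 to $\mathfrak{N}:S\to\mathsf{Gr}(V)$ is a Galois connection $f_\diamond : R\leftrightarrows S : f^\diamond$ with $(f_\diamond)_\sharp\mathfrak{M}\simeq\mathfrak{N}$; its cost is $\mathrm{dis}(f_\diamond)$. Edit distance: in a category $\mathcal{C}$ in which each morphism has a cost, a path between objects $A$ and $B$ is a finite sequence of morphisms $A\leftrightarrow D_1\leftrightarrow\cdots\leftrightarrow D_{k-1}\leftrightarrow B$, each in either direction; its cost is the sum of the costs of its morphisms; $d^E_{\mathcal{C}}(A,B)$ is the infimum of the costs of all paths between $A$ and $B$ ($\infty$ if there are none). *)

theory Defs
  imports "HOL-Analysis.Analysis"
begin

section \<open>Grassmannian\<close>

text \<open>Addition and finite sums of subspaces are the Minkowski operations of
  \<^theory>\<open>HOL-Library.Set_Algebras\<close>: \<open>W1 + W2 = {a + b | a \<in> W1, b \<in> W2}\<close>, with neutral element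
  \<open>0 = {0}\<close>, so that in particular an empty sum is \<open>{0}\<close>.\<close>

definition Gr :: "'v::real_vector set \<Rightarrow> 'v set set" where
  "Gr V = {W. subspace W \<and> W \<subseteq> V}"

definition ominus :: "'v::real_inner set \<Rightarrow> 'v set \<Rightarrow> 'v set" (infixl "\<ominus>" 65) where
  "W1 \<ominus> W2 = W1 \<inter> W2\<^sup>\<bottom>"


section \<open>Finite metric posets\<close>

text \<open>The points of a poset are a finite subset of a type \<open>'a\<close>. To make equality of structures the
  mathematical one, the order relation is contained in the square of the set of points (this is
  part of \<^const>\<open>partial_order_on\<close>), and metrics and functions are \<open>undefined\<close> off their domains.\<close>

record 'a mposet =
  pts :: "'a set"
  ord :: "('a \<times> 'a) set"
  mdist :: "'a \<times> 'a \<Rightarrow> ennreal"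

definition le_in :: "'a mposet \<Rightarrow> 'a \<Rightarrow> 'a \<Rightarrow> bool" where
  "le_in P x y \<longleftrightarrow> (x, y) \<in> ord P"

definition below :: "'a mposet \<Rightarrow> 'a \<Rightarrow> 'a set" where
  "below P x = {y \<in> pts P. le_in P y x \<and> y \<noteq> x}"

definition below_eq :: "'a mposet \<Rightarrow> 'a \<Rightarrow> 'a set" where
  "below_eq P x = {y \<in> pts P. le_in P y x}"

definition extended_metric_on :: "'a set \<Rightarrow> ('a \<times> 'a \<Rightarrow> ennreal) \<Rightarrow> bool" where
  "extended_metric_on A d \<longleftrightarrow>
     (\<forall>x\<in>A. \<forall>y\<in>A. d (x, y) = 0 \<longleftrightarrow> x = y) \<and>
     (\<forall>x\<in>A. \<forall>y\<in>A. d (x, y) = d (y, x)) \<and>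
     (\<forall>x\<in>A. \<forall>y\<in>A. \<forall>z\<in>A. d (x, z) \<le> d (x, y) + d (y, z))"

definition finite_metric_poset :: "'a mposet \<Rightarrow> bool" where
  "finite_metric_poset P \<longleftrightarrow>
     finite (pts P) \<and>
     partial_order_on (pts P) (ord P) \<and>
     mdist P \<in> extensional (pts P \<times> pts P) \<and>
     extended_metric_on (pts P) (mdist P) \<and>
     (\<forall>x\<in>pts P. \<forall>y\<in>pts P. \<forall>z\<in>pts P. le_in P x y \<and> le_in P y z \<longrightarrow>
        mdist P (x, y) \<le> mdist P (x, z) \<and> mdist P (y, z) \<le> mdist P (x, z))"

text \<open>The case distinction implements \<open>\<bar>\<infinity> - \<infinity>\<bar> = 0\<close>; in \<^typ>\<open>ennreal\<close> itself \<open>\<infinity> - \<infinity> = \<infinity>\<close>.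
  Otherwise one of the two truncated differences is the absolute difference and the other is \<open>0\<close>.\<close>

definition abs_diff :: "ennreal \<Rightarrow> ennreal \<Rightarrow> ennreal" where
  "abs_diff a b = (if a = \<infinity> \<and> b = \<infinity> then 0 else max (a - b) (b - a))"

text \<open>A supremum over a finite index set, hence a maximum (and \<open>0\<close> for the empty poset).\<close>

definition distortion :: "'a mposet \<Rightarrow> 'a mposet \<Rightarrow> ('a \<Rightarrow> 'a) \<Rightarrow> ennreal" where
  "distortion P Q \<alpha> =
     (SUP (x, y) \<in> pts P \<times> pts P. abs_diff (mdist P (x, y)) (mdist Q (\<alpha> x, \<alpha> y)))"


section \<open>Galois connections\<close>

text \<open>A Galois connection is the pair \<open>(l, u)\<close> of its lower (left) adjoint and its upper (right)
  adjoint.\<close>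

type_synonym 'a galois = "('a \<Rightarrow> 'a) \<times> ('a \<Rightarrow> 'a)"

definition galois_connection :: "'a mposet \<Rightarrow> 'a mposet \<Rightarrow> 'a galois \<Rightarrow> bool" where
  "galois_connection R S = (\<lambda>(l, u).
     l \<in> pts R \<rightarrow>\<^sub>E pts S \<and> u \<in> pts S \<rightarrow>\<^sub>E pts R \<and>
     monotone_on (pts R) (le_in R) (le_in S) l \<and>
     monotone_on (pts S) (le_in S) (le_in R) u \<and>
     (\<forall>r\<in>pts R. \<forall>s\<in>pts S. le_in S (l r) s \<longleftrightarrow> le_in R r (u s)))"

definition galois_id :: "'a mposet \<Rightarrow> 'a galois" where
  "galois_id R = (restrict id (pts R), restrict id (pts R))"

text \<open>Here \<open>f\<close> connects \<open>R\<close> with some poset, and \<open>g\<close> connects that poset with \<open>T\<close>.\<close>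

definition galois_comp :: "'a mposet \<Rightarrow> 'a mposet \<Rightarrow> 'a galois \<Rightarrow> 'a galois \<Rightarrow> 'a galois" where
  "galois_comp R T g f =
     (compose (pts R) (fst g) (fst f), compose (pts T) (snd f) (snd g))"


section \<open>Functions from a poset to the Grassmannian\<close>

definition monotone_space_function ::
    "'v::real_inner set \<Rightarrow> 'a mposet \<Rightarrow> ('a \<Rightarrow> 'v set) \<Rightarrow> bool" where
  "monotone_space_function V R F \<longleftrightarrow>
     F \<in> pts R \<rightarrow>\<^sub>E Gr V \<and> monotone_on (pts R) (le_in R) (\<subseteq>) F"

definition OI :: "'a mposet \<Rightarrow> ('a \<Rightarrow> 'v::real_inner set) \<Rightarrow> ('a \<Rightarrow> 'v set)" where
  "OI R F = (\<lambda>r\<in>pts R. F r \<ominus> (\<Sum>r'\<in>below R r. F r'))"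

definition downward_transversal ::
    "'v::real_inner set \<Rightarrow> 'a mposet \<Rightarrow> ('a \<Rightarrow> 'v set) \<Rightarrow> bool" where
  "downward_transversal V R M \<longleftrightarrow>
     M \<in> pts R \<rightarrow>\<^sub>E Gr V \<and>
     (\<forall>r\<in>pts R. dim (M r + (\<Sum>r'\<in>below R r. M r')) = dim (M r) + dim (\<Sum>r'\<in>below R r. M r'))"

definition moebius_equiv ::
    "'a mposet \<Rightarrow> ('a \<Rightarrow> 'v::real_inner set) \<Rightarrow> ('a \<Rightarrow> 'v set) \<Rightarrow> bool" where
  "moebius_equiv R m1 m2 \<longleftrightarrow>
     (\<forall>r\<in>pts R. (\<Sum>r'\<in>below_eq R r. m1 r') = (\<Sum>r'\<in>below_eq R r. m2 r'))"

definition pushforward ::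
    "'a mposet \<Rightarrow> 'a mposet \<Rightarrow> ('a \<Rightarrow> 'a) \<Rightarrow> ('a \<Rightarrow> 'v::real_inner set) \<Rightarrow> ('a \<Rightarrow> 'v set)" where
  "pushforward R S l M = (\<lambda>s\<in>pts S. \<Sum>r\<in>{r \<in> pts R. l r = s}. M r)"


section \<open>Categories with costs, functors, edit distance\<close>

text \<open>Morphisms do not carry their source and target (the same Galois connection can be a morphism
  between several pairs of objects), so composition and cost take the relevant objects as
  arguments: \<open>compos C A1 A2 A3 g f\<close> composes \<open>f \<in> hom C A1 A2\<close> with \<open>g \<in> hom C A2 A3\<close>.\<close>

record ('o, 'm) cost_cat =
  obj :: "'o set"
  hom :: "'o \<Rightarrow> 'o \<Rightarrow> 'm set"
  ident :: "'o \<Rightarrow> 'm"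
  compos :: "'o \<Rightarrow> 'o \<Rightarrow> 'o \<Rightarrow> 'm \<Rightarrow> 'm \<Rightarrow> 'm"
  cost :: "'o \<Rightarrow> 'o \<Rightarrow> 'm \<Rightarrow> ennreal"

definition category :: "('o, 'm) cost_cat \<Rightarrow> bool" where
  "category C \<longleftrightarrow>
     (\<forall>A\<in>obj C. ident C A \<in> hom C A A) \<and>
     (\<forall>A1\<in>obj C. \<forall>A2\<in>obj C. \<forall>A3\<in>obj C. \<forall>f\<in>hom C A1 A2. \<forall>g\<in>hom C A2 A3.
        compos C A1 A2 A3 g f \<in> hom C A1 A3) \<and>
     (\<forall>A\<in>obj C. \<forall>B\<in>obj C. \<forall>f\<in>hom C A B.
        compos C A A B f (ident C A) = f \<and> compos C A B B (ident C B) f = f) \<and>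
     (\<forall>A1\<in>obj C. \<forall>A2\<in>obj C. \<forall>A3\<in>obj C. \<forall>A4\<in>obj C.
        \<forall>f\<in>hom C A1 A2. \<forall>g\<in>hom C A2 A3. \<forall>h\<in>hom C A3 A4.
        compos C A1 A3 A4 h (compos C A1 A2 A3 g f) = compos C A1 A2 A4 (compos C A2 A3 A4 h g) f)"

definition is_functor ::
    "('o, 'm) cost_cat \<Rightarrow> ('p, 'n) cost_cat \<Rightarrow> ('o \<Rightarrow> 'p) \<Rightarrow> ('o \<Rightarrow> 'o \<Rightarrow> 'm \<Rightarrow> 'n) \<Rightarrow> bool" where
  "is_functor C D Fo Fm \<longleftrightarrow>
     category C \<and> category D \<and>
     (\<forall>A\<in>obj C. Fo A \<in> obj D) \<and>
     (\<forall>A\<in>obj C. \<forall>B\<in>obj C. \<forall>f\<in>hom C A B. Fm A B f \<in> hom D (Fo A) (Fo B)) \<and>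
     (\<forall>A\<in>obj C. Fm A A (ident C A) = ident D (Fo A)) \<and>
     (\<forall>A1\<in>obj C. \<forall>A2\<in>obj C. \<forall>A3\<in>obj C. \<forall>f\<in>hom C A1 A2. \<forall>g\<in>hom C A2 A3.
        Fm A1 A3 (compos C A1 A2 A3 g f) =
        compos D (Fo A1) (Fo A2) (Fo A3) (Fm A2 A3 g) (Fm A1 A2 f))"

text \<open>\<open>zigzag C A B c\<close>: there is a path of total cost \<open>c\<close> from \<open>A\<close> to \<open>B\<close>, each of whose (one or more)
  morphisms may point in either direction.\<close>

inductive zigzag :: "('o, 'm) cost_cat \<Rightarrow> 'o \<Rightarrow> 'o \<Rightarrow> ennreal \<Rightarrow> bool" for C where
  forward: "A \<in> obj C \<Longrightarrow> B \<in> obj C \<Longrightarrow> f \<in> hom C A B \<Longrightarrow> zigzag C A B (cost C A B f)"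
| backward: "A \<in> obj C \<Longrightarrow> B \<in> obj C \<Longrightarrow> f \<in> hom C B A \<Longrightarrow> zigzag C A B (cost C B A f)"
| concat: "zigzag C A D c \<Longrightarrow> zigzag C D B c' \<Longrightarrow> zigzag C A B (c + c')"

text \<open>In \<^typ>\<open>ennreal\<close> the infimum of the empty set is \<open>\<infinity>\<close>.\<close>

definition edit_distance :: "('o, 'm) cost_cat \<Rightarrow> 'o \<Rightarrow> 'o \<Rightarrow> ennreal" where
  "edit_distance C A B = Inf {c. zigzag C A B c}"


section \<open>The two categories\<close>

text \<open>An object is a pair of a finite metric poset and a function on it. All posets have their
  points in one type \<open>'a\<close>. For infinite \<open>'a\<close> this does not affect the edit distance: every finite
  poset is isomorphic to one with points in \<open>'a\<close>, and the interior objects of a path can be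
  replaced by isomorphic copies without changing the costs.\<close>

type_synonym ('a, 'v) space_fun = "'a mposet \<times> ('a \<Rightarrow> 'v set)"

definition Mon :: "'v::real_inner set \<Rightarrow> (('a, 'v) space_fun, 'a galois) cost_cat" where
  "Mon V = \<lparr>
     obj = {(R, F). finite_metric_poset R \<and> monotone_space_function V R F},
     hom = (\<lambda>(R, F) (S, G).
       {(l, u). galois_connection R S (l, u) \<and> (\<forall>s\<in>pts S. F (u s) = G s)}),
     ident = (\<lambda>(R, F). galois_id R),
     compos = (\<lambda>(R, F) (S, G) (T, H). galois_comp R T),
     cost = (\<lambda>(R, F) (S, G) (l, u). distortion R S l)\<rparr>"

definition DT_Fnc :: "'v::real_inner set \<Rightarrow> (('a, 'v) space_fun, 'a galois) cost_cat" where
  "DT_Fnc V = \<lparr>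
     obj = {(R, M). finite_metric_poset R \<and> downward_transversal V R M},
     hom = (\<lambda>(R, M) (S, N).
       {(l, u). galois_connection R S (l, u) \<and> moebius_equiv S (pushforward R S l M) N}),
     ident = (\<lambda>(R, M). galois_id R),
     compos = (\<lambda>(R, M) (S, N) (T, K). galois_comp R T),
     cost = (\<lambda>(R, M) (S, N) (l, u). distortion R S l)\<rparr>"

definition OI_obj :: "('a, 'v::real_inner) space_fun \<Rightarrow> ('a, 'v) space_fun" where
  "OI_obj = (\<lambda>(R, F). (R, OI R F))"

end

theory Submission
  imports Defs
begin

text \<open>A function on a finite poset with values in the Grassmannian is judged, up to Moebius equivalence,
  by its cumulative sums, the sums over all points below a given one. The proof is about two
  formulas for them.

  The orthogonal inverse inverts cumulative summation: the cumulative sums of \<open>OI R F\<close> are the values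
  of \<open>F\<close> (lemma \<open>cumulative_sum_OI\<close>). This goes by induction over the poset. If it holds strictly
  below \<open>r\<close>, then \<open>OI R F\<close> and \<open>F\<close> have the same sum \<open>B\<close> over the points strictly below \<open>r\<close>. Monotonicity
  gives \<open>B \<subseteq> F r\<close>, and orthogonal projection to the finite-dimensional space \<open>B\<close> splits \<open>F r\<close> as
  \<open>(F r \<ominus> B) + B\<close>. The two parts meet only in \<open>0\<close>, so their dimensions add, which is the downward
  transversality of \<open>OI R F\<close>.

  On cumulative sums, pushing forward along the lower adjoint of a Galois connection is pulling
  back along the upper adjoint (lemma \<open>cumulative_sum_pushforward\<close>), because
  \<open>l r \<le> s\<close> holds iff \<open>r \<le> u s\<close>.

  Together they make the functor work: at \<open>s\<close> the cumulative sum of the pushforward of \<open>OI R F\<close> is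
  \<open>F (u s)\<close> and that of \<open>OI S G\<close> is \<open>G s\<close>, and these agree for a morphism from \<open>F\<close> to \<open>G\<close>. The second
  formula alone shows that morphisms of downward transversal functions compose. The costs
  depend only on the Galois connection, so the functor takes paths to paths of the same cost, and
  the infimum over paths can only drop.\<close>

section \<open>Finite-dimensional subspaces of an inner product space\<close>

lemma sum_subspaces_eq_span:
  assumes "finite I" and "\<And>i. i \<in> I \<Longrightarrow> subspace (W i)"
  shows "(\<Sum>i\<in>I. W i) = span (\<Union>i\<in>I. W i)"
  using assms
proof (induction I rule: finite_induct)
  case empty
  then show ?case by (simp add: set_zero)
next
  case (insert i I)
  then have "(\<Sum>j\<in>insert i I. W j) = span (W i) + span (\<Union>j\<in>I. W j)"
    by (simp add: span_eq_iff[THEN iffD2])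
  also have "\<dots> = span (\<Union>j\<in>insert i I. W j)"
    by (auto simp: span_Un set_plus_def)
  finally show ?case .
qed

lemma subspace_sum_subspaces:
  assumes "finite I" and "\<And>i. i \<in> I \<Longrightarrow> subspace (W i)"
  shows "subspace (\<Sum>i\<in>I. W i)"
  using sum_subspaces_eq_span[OF assms] by simp

lemma sum_subspaces_least:
  assumes "finite I" and "\<And>i. i \<in> I \<Longrightarrow> subspace (W i)" and "subspace U"
    and "\<And>i. i \<in> I \<Longrightarrow> W i \<subseteq> U"
  shows "(\<Sum>i\<in>I. W i) \<subseteq> U"
proof -
  have "(\<Union>i\<in>I. W i) \<subseteq> U" using assms(4) by (rule UN_least)
  then have "span (\<Union>i\<in>I. W i) \<subseteq> U" using assms(3) by (rule span_minimal)
  then show ?thesis using assms(1,2) by (simp add: sum_subspaces_eq_span)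
qed

lemma summand_subset_sum_subspaces:
  assumes "finite I" and "\<And>i. i \<in> I \<Longrightarrow> subspace (W i)" and "i \<in> I"
  shows "W i \<subseteq> (\<Sum>i\<in>I. W i)"
proof -
  have "W i \<subseteq> (\<Union>i\<in>I. W i)" using assms(3) by (rule UN_upper)
  also have "\<dots> \<subseteq> span (\<Union>i\<in>I. W i)" by (rule span_superset)
  finally show ?thesis using assms(1,2) by (simp add: sum_subspaces_eq_span)
qed

text \<open>One Gram--Schmidt step: if \<open>b = b0 + b1\<close> is the decomposition of the new generator with respect to
  the old span, then \<open>b1\<close> is the only new direction, and the component along \<open>b1\<close> is moved from the
  orthogonal part of \<open>x\<close> to its projection.\<close>

lemma orthogonal_decomp_span_finite:
  fixes x :: "'v::real_inner"
  assumes "finite B"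
  shows "\<exists>y\<in>span B. x - y \<in> (span B)\<^sup>\<bottom>"
  using assms
proof (induction B arbitrary: x rule: finite_induct)
  case empty
  then show ?case by simp
next
  case (insert b B)
  obtain b0 where b0: "b0 \<in> span B" "b - b0 \<in> (span B)\<^sup>\<bottom>" using insert.IH by blast
  obtain x0 where x0: "x0 \<in> span B" "x - x0 \<in> (span B)\<^sup>\<bottom>" using insert.IH by blast
  define b1 where "b1 = b - b0"
  \<comment> \<open>For \<open>b1 = 0\<close> the coefficient is \<open>0\<close> by the convention on division, which is the right value.\<close>
  define c where "c = ((x - x0) \<bullet> b1) / (b1 \<bullet> b1)"
  have old_span: "b0 \<in> span (insert b B)" "x0 \<in> span (insert b B)"
    using b0 x0 span_mono[of B "insert b B"] by auto
  have b1_span: "b1 \<in> span (insert b B)"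
    unfolding b1_def by (intro span_diff old_span span_base) simp
  have orth: "(x - (x0 + c *\<^sub>R b1)) \<bullet> w = 0" if "w \<in> span B" for w
    using b0 x0 that
    by (simp add: orthogonal_comp_def orthogonal_def b1_def inner_commute[of _ w] inner_diff_right
        inner_add_right)
  have orth_b1: "(x - (x0 + c *\<^sub>R b1)) \<bullet> b1 = 0"
    by (cases "b1 = 0") (simp_all add: c_def inner_diff_left inner_add_left)
  have "(x - (x0 + c *\<^sub>R b1)) \<in> (span (insert b B))\<^sup>\<bottom>"
    unfolding orthogonal_comp_def
  proof (intro CollectI ballI)
    fix w assume "w \<in> span (insert b B)"
    then obtain k where k: "w - k *\<^sub>R b \<in> span B" by (auto simp: span_insert)
    have "w - k *\<^sub>R b1 = (w - k *\<^sub>R b) + k *\<^sub>R b0"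
      by (simp add: b1_def algebra_simps)
    also have "\<dots> \<in> span B"
      using k b0 by (intro span_add span_scale) auto
    finally have "w - k *\<^sub>R b1 \<in> span B" .
    from orth[OF this] have "(x - (x0 + c *\<^sub>R b1)) \<bullet> w - k * ((x - (x0 + c *\<^sub>R b1)) \<bullet> b1) = 0"
      by (simp only: inner_diff_right inner_scaleR_right)
    with orth_b1 show "orthogonal w (x - (x0 + c *\<^sub>R b1))"
      by (simp add: orthogonal_def inner_commute[of w])
  qed
  moreover have "x0 + c *\<^sub>R b1 \<in> span (insert b B)"
    by (intro span_add span_scale old_span b1_span)
  ultimately show ?case by blast
qed

lemma finite_basis_of_subspace:
  assumes "subspace W" and "W \<subseteq> span B" and "finite B"
  obtains C where "finite C" "independent C" "span C = W" "card C = dim W"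
proof -
  obtain C where C: "C \<subseteq> W" "independent C" "W \<subseteq> span C" "card C = dim W"
    by (rule basis_exists)
  then have "span C = W" using assms(1) by (simp add: span_minimal subset_antisym)
  moreover have "finite C"
    using independent_span_bound[OF assms(3) C(2)] C(1) assms(2) by auto
  ultimately show thesis using that C by blast
qed

text \<open>If a generator \<open>a\<close> of the first span were \<open>x + y\<close> with \<open>x\<close> spanned by the other elements of \<open>A\<close>, then
  \<open>y = a - x\<close> would lie in both spans, so \<open>a = x\<close>, against the independence of \<open>A\<close>.\<close>

lemma independent_Un_if_spans_meet_trivially:
  assumes "finite A" and "independent A" and "independent B" and "span A \<inter> span B \<subseteq> {0}"
  shows "independent (A \<union> B)"
  using assms
proof (induction A rule: finite_induct)
  case empty
  then show ?case by simp
next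
  case (insert a A)
  have indep: "independent A" "a \<notin> span A"
    using insert.prems(1) insert.hyps(2) by (auto simp: independent_insert)
  have "span A \<subseteq> span (insert a A)" by (intro span_mono) auto
  with insert indep have IH: "independent (A \<union> B)" by blast
  have "a \<notin> span (A \<union> B)"
  proof
    assume "a \<in> span (A \<union> B)"
    then obtain x y where xy: "a = x + y" "x \<in> span A" "y \<in> span B" by (auto simp: span_Un)
    have "a - x \<in> span (insert a A)"
      using xy(2) \<open>span A \<subseteq> span (insert a A)\<close> by (auto intro!: span_diff intro: span_base)
    with xy insert.prems(3) have "y = 0" by auto
    with xy indep show False by simp
  qed
  with IH show ?case by (simp add: independent_insertI)
qed

text \<open>The type of vectors may be infinite-dimensional, where \<open>dim\<close> is \<open>0\<close> on subspaces without a finite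
  basis; the common finite spanning set \<open>E\<close> rules this out.\<close>

lemma dim_plus_if_meet_trivially:
  assumes "subspace A" and "subspace B" and "A \<inter> B \<subseteq> {0}"
    and "A \<subseteq> span E" and "B \<subseteq> span E" and "finite E"
  shows "dim (A + B) = dim A + dim B"
proof -
  obtain C where C: "finite C" "independent C" "span C = A" "card C = dim A"
    using finite_basis_of_subspace assms by blast
  obtain D where D: "finite D" "independent D" "span D = B" "card D = dim B"
    using finite_basis_of_subspace assms by blast
  have "independent (C \<union> D)"
    using independent_Un_if_spans_meet_trivially C D assms(3) by blast
  moreover have "span (C \<union> D) = A + B"
    using C(3) D(3) by (auto simp: span_Un set_plus_def)
  moreover have "C \<inter> D = {}"
    using C D assms(3) span_base dependent_zero by blast
  ultimately show ?thesis
    using C D dim_eq_card[of "C \<union> D" "A + B"] by (metis card_Un_disjoint span_span)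
qed

lemma orthogonal_complement_meets_trivially: "(A \<ominus> B) \<inter> B \<subseteq> {0}"
  by (auto simp: ominus_def orthogonal_comp_def orthogonal_def)

lemma subspace_ominus: "subspace A \<Longrightarrow> subspace (A \<ominus> B)"
  by (simp add: ominus_def subspace_inter subspace_orthogonal_comp)

text \<open>The projection to \<open>B\<close> of a vector of \<open>A\<close> lies in \<open>A\<close> because \<open>B \<subseteq> A\<close>; hence so does the
  orthogonal remainder.\<close>

lemma ominus_plus_cancel:
  assumes "subspace A" and "subspace B" and "B \<subseteq> A" and "A \<subseteq> span E" and "finite E"
  shows "(A \<ominus> B) + B = A"
proof
  show "(A \<ominus> B) + B \<subseteq> A"
    using assms by (auto simp: ominus_def set_plus_def subspace_add)
next
  obtain C where C: "finite C" "span C = B"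
    using finite_basis_of_subspace[OF assms(2) _ assms(5)] assms by blast
  show "A \<subseteq> (A \<ominus> B) + B"
  proof
    fix x assume x: "x \<in> A"
    obtain y where y: "y \<in> B" "x - y \<in> B\<^sup>\<bottom>"
      using orthogonal_decomp_span_finite[OF C(1), of x] C(2) by blast
    with x assms have "x - y \<in> A \<ominus> B" by (auto simp: ominus_def subspace_diff)
    then have "(x - y) + y \<in> (A \<ominus> B) + B" using y(1) by (rule set_plus_intro)
    then show "x \<in> (A \<ominus> B) + B" by simp
  qed
qed


section \<open>Cumulative sums and Galois connections\<close>

locale finite_poset =
  fixes R :: "'a mposet"
  assumes finite_pts: "finite (pts R)"
    and order: "partial_order_on (pts R) (ord R)"
begin

lemma le_refl: "r \<in> pts R \<Longrightarrow> le_in R r r"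
  using order by (auto simp: partial_order_on_def preorder_on_def refl_on_def le_in_def)

lemma le_trans: "le_in R x y \<Longrightarrow> le_in R y z \<Longrightarrow> le_in R x z"
  using order by (auto simp: partial_order_on_def preorder_on_def le_in_def dest: transD)

lemma le_antisym: "le_in R x y \<Longrightarrow> le_in R y x \<Longrightarrow> x = y"
  using order by (auto simp: partial_order_on_def le_in_def dest: antisymD)

lemma finite_below: "finite (below R r)" and finite_below_eq: "finite (below_eq R r)"
  using finite_pts by (simp_all add: below_def below_eq_def)

lemma below_eq_insert: "r \<in> pts R \<Longrightarrow> below_eq R r = insert r (below R r)"
  by (auto simp: below_def below_eq_def le_refl)

lemma sum_below_eq:
  fixes f :: "'a \<Rightarrow> 'b::comm_monoid_add"
  assumes "r \<in> pts R"
  shows "(\<Sum>r'\<in>below_eq R r. f r') = f r + (\<Sum>r'\<in>below R r. f r')"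
proof -
  have "r \<notin> below R r" by (simp add: below_def)
  then show ?thesis using assms by (simp add: below_eq_insert finite_below)
qed

lemma below_psubset: "r' \<in> below R r \<Longrightarrow> below R r' \<subset> below R r"
  by (auto simp: below_def dest: le_trans le_antisym)

lemma below_eq_subset_below: "r' \<in> below R r \<Longrightarrow> below_eq R r' \<subseteq> below R r"
  by (auto simp: below_def below_eq_def dest: le_trans le_antisym)

lemma below_induct [consumes 1, case_names less]:
  assumes "r \<in> pts R"
    and "\<And>r. r \<in> pts R \<Longrightarrow> (\<And>r'. r' \<in> below R r \<Longrightarrow> Q r') \<Longrightarrow> Q r"
  shows "Q r"
  using assms(1)
proof (induction "card (below R r)" arbitrary: r rule: less_induct)
  case less
  show ?case
  proof (rule assms(2)[OF less.prems])
    fix r' assume r': "r' \<in> below R r"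
    then have "card (below R r') < card (below R r)"
      by (intro psubset_card_mono finite_below below_psubset)
    with r' show "Q r'" by (intro less.hyps) (simp_all add: below_def)
  qed
qed

text \<open>Sums of subspaces are idempotent, so it does not matter that the summand \<open>M r''\<close> occurs once in
  every \<open>W r'\<close> with \<open>r'' \<le> r'\<close>.\<close>

lemma sum_below_of_cumulative_sums:
  assumes sub: "\<And>r'. r' \<in> below R r \<Longrightarrow> subspace (M r')"
    and W: "\<And>r'. r' \<in> below R r \<Longrightarrow> (\<Sum>r''\<in>below_eq R r'. M r'') = W r'"
  shows "(\<Sum>r'\<in>below R r. M r') = (\<Sum>r'\<in>below R r. W r')"
proof
  have subW: "subspace (W r')" if "r' \<in> below R r" for r'
    using W[OF that] subspace_sum_subspaces[OF finite_below_eq, of r' M] sub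
      below_eq_subset_below[OF that] by auto
  show "(\<Sum>r'\<in>below R r. M r') \<subseteq> (\<Sum>r'\<in>below R r. W r')"
  proof (intro sum_subspaces_least finite_below subspace_sum_subspaces sub subW)
    fix r' assume r': "r' \<in> below R r"
    have "r' \<in> below_eq R r'" using r' by (auto simp: below_def below_eq_def le_refl)
    then have "M r' \<subseteq> W r'"
      using W[OF r'] summand_subset_sum_subspaces[OF finite_below_eq, of r' M] sub
        below_eq_subset_below[OF r'] by blast
    also have "\<dots> \<subseteq> (\<Sum>r'\<in>below R r. W r')"
      using r' subW by (intro summand_subset_sum_subspaces finite_below)
    finally show "M r' \<subseteq> (\<Sum>r'\<in>below R r. W r')" .
  qed
  show "(\<Sum>r'\<in>below R r. W r') \<subseteq> (\<Sum>r'\<in>below R r. M r')"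
  proof (intro sum_subspaces_least finite_below subspace_sum_subspaces sub subW)
    fix r' assume r': "r' \<in> below R r"
    have "(\<Sum>r''\<in>below_eq R r'. M r'') \<subseteq> (\<Sum>r'\<in>below R r. M r')"
      using below_eq_subset_below[OF r'] sub
      by (intro sum_subspaces_least finite_below_eq subspace_sum_subspaces finite_below
          summand_subset_sum_subspaces) auto
    then show "W r' \<subseteq> (\<Sum>r'\<in>below R r. M r')" using W[OF r'] by simp
  qed
qed

end

lemma finite_metric_poset_imp_finite_poset: "finite_metric_poset R \<Longrightarrow> finite_poset R"
  by (simp add: finite_metric_poset_def finite_poset_def)

lemma galois_connectionD:
  assumes "galois_connection R S (l, u)"
  shows "l \<in> pts R \<rightarrow>\<^sub>E pts S" and "u \<in> pts S \<rightarrow>\<^sub>E pts R"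
    and "monotone_on (pts R) (le_in R) (le_in S) l" and "monotone_on (pts S) (le_in S) (le_in R) u"
    and "r \<in> pts R \<Longrightarrow> s \<in> pts S \<Longrightarrow> le_in S (l r) s \<longleftrightarrow> le_in R r (u s)"
  using assms unfolding galois_connection_def by auto

lemma galois_connection_mem:
  assumes "galois_connection R S (l, u)"
  shows "r \<in> pts R \<Longrightarrow> l r \<in> pts S" and "s \<in> pts S \<Longrightarrow> u s \<in> pts R"
  using PiE_mem[OF galois_connectionD(1)[OF assms]] PiE_mem[OF galois_connectionD(2)[OF assms]]
  by blast+

lemma galois_below_eq:
  assumes "galois_connection R S (l, u)" and "s \<in> pts S"
  shows "{r \<in> pts R. l r \<in> below_eq S s} = below_eq R (u s)"
proof (rule set_eqI)
  fix r
  show "r \<in> {r \<in> pts R. l r \<in> below_eq S s} \<longleftrightarrow> r \<in> below_eq R (u s)"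
    using galois_connection_mem(1)[OF assms(1), of r] galois_connectionD(5)[OF assms(1) _ assms(2), of r]
    by (auto simp: below_eq_def)
qed

text \<open>The pushforward regroups summands along the fibres of \<open>l\<close>, and by adjunction the fibres over
  the points below \<open>s\<close> make up exactly the points below \<open>u s\<close>. On cumulative sums the pushforward
  along the lower adjoint is therefore the pullback along the upper adjoint.\<close>

lemma cumulative_sum_pushforward:
  assumes R: "finite_poset R" and S: "finite_poset S"
    and gal: "galois_connection R S (l, u)" and s: "s \<in> pts S"
  shows "(\<Sum>s'\<in>below_eq S s. pushforward R S l M s') = (\<Sum>r\<in>below_eq R (u s). M r)"
proof -
  interpret R: finite_poset R by fact
  interpret S: finite_poset S by fact
  have "{r \<in> below_eq R (u s). l r = s'} = {r \<in> pts R. l r = s'}" if "s' \<in> below_eq S s" for s'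
    using that galois_below_eq[OF gal s] by auto
  moreover have "s' \<in> pts S" if "s' \<in> below_eq S s" for s'
    using that by (simp add: below_eq_def)
  ultimately have "(\<Sum>s'\<in>below_eq S s. pushforward R S l M s')
      = (\<Sum>s'\<in>below_eq S s. \<Sum>r\<in>{r \<in> below_eq R (u s). l r = s'}. M r)"
    by (intro sum.cong) (simp_all add: pushforward_def)
  also have "\<dots> = (\<Sum>r\<in>below_eq R (u s). M r)"
    using galois_below_eq[OF gal s]
    by (intro sum.group R.finite_below_eq S.finite_below_eq) auto
  finally show ?thesis .
qed


section \<open>Orthogonal inversion\<close>

lemma monotone_space_functionD:
  assumes "monotone_space_function V R F"
  shows "r \<in> pts R \<Longrightarrow> subspace (F r)" and "r \<in> pts R \<Longrightarrow> F r \<subseteq> V"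
    and "r' \<in> below R r \<Longrightarrow> r \<in> pts R \<Longrightarrow> F r' \<subseteq> F r"
  using assms by (auto simp: monotone_space_function_def Gr_def below_def monotone_on_def)

text \<open>By induction, the sum of \<open>OI R F\<close> over the points strictly below \<open>r\<close> equals that of \<open>F\<close>; then \<open>OI R F r\<close> is
  a complement of this sum in \<open>F r\<close>.\<close>

lemma cumulative_sum_OI:
  assumes R: "finite_poset R" and F: "monotone_space_function V R F"
    and V: "V \<subseteq> span E" "finite E" and r: "r \<in> pts R"
  shows "(\<Sum>r'\<in>below_eq R r. OI R F r') = F r"
proof -
  interpret finite_poset R by fact
  note F = monotone_space_functionD[OF F]
  show ?thesis
    using r
  proof (induction rule: below_induct)
    case (less r)
    let ?B = "\<Sum>r'\<in>below R r. F r'"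
    have pts: "r' \<in> pts R" if "r' \<in> below R r" for r' using that by (simp add: below_def)
    have "(\<Sum>r'\<in>below R r. OI R F r') = ?B"
      using less.IH pts F(1) by (intro sum_below_of_cumulative_sums) (auto simp: OI_def subspace_ominus)
    then have "(\<Sum>r'\<in>below_eq R r. OI R F r') = (F r \<ominus> ?B) + ?B"
      using less.hyps by (simp add: sum_below_eq OI_def)
    also have "\<dots> = F r"
    proof (rule ominus_plus_cancel)
      show "subspace (F r)" using F less.hyps by simp
      show "subspace ?B" by (intro subspace_sum_subspaces finite_below F pts)
      show "?B \<subseteq> F r" using F less.hyps pts by (intro sum_subspaces_least finite_below) auto
      show "F r \<subseteq> span E" using F(2) less.hyps V by blast
    qed fact
    finally show ?case .
  qed
qed

lemma sum_below_OI:
  assumes R: "finite_poset R" and F: "monotone_space_function V R F"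
    and V: "V \<subseteq> span E" "finite E"
  shows "(\<Sum>r'\<in>below R r. OI R F r') = (\<Sum>r'\<in>below R r. F r')"
proof -
  interpret finite_poset R by fact
  have pts: "r' \<in> pts R" if "r' \<in> below R r" for r' using that by (simp add: below_def)
  show ?thesis
    using cumulative_sum_OI[OF R F V] monotone_space_functionD(1)[OF F] pts
    by (intro sum_below_of_cumulative_sums) (auto simp: OI_def subspace_ominus)
qed

text \<open>The sum of the \<open>OI R F r'\<close> below \<open>r\<close> equals the sum of the \<open>F r'\<close>, to which \<open>OI R F r\<close> is
  orthogonal by construction, so the dimensions add.\<close>

lemma downward_transversal_OI:
  assumes R: "finite_poset R" and F: "monotone_space_function V R F"
    and V: "subspace V" "V \<subseteq> span E" "finite E"
  shows "downward_transversal V R (OI R F)"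
proof -
  interpret finite_poset R by fact
  note F' = monotone_space_functionD[OF F]
  have "OI R F \<in> pts R \<rightarrow>\<^sub>E Gr V"
    using F' by (auto simp: OI_def Gr_def subspace_ominus) (auto simp: ominus_def)
  moreover have "dim (OI R F r + (\<Sum>r'\<in>below R r. OI R F r'))
      = dim (OI R F r) + dim (\<Sum>r'\<in>below R r. OI R F r')" if r: "r \<in> pts R" for r
    unfolding sum_below_OI[OF R F V(2,3)]
  proof (rule dim_plus_if_meet_trivially[OF _ _ _ _ _ V(3)])
    let ?B = "\<Sum>r'\<in>below R r. F r'"
    have pts: "r' \<in> pts R" if "r' \<in> below R r" for r' using that by (simp add: below_def)
    have M: "OI R F r = F r \<ominus> ?B" using r by (simp add: OI_def)
    show "subspace (OI R F r)" using F'(1) r M by (simp add: subspace_ominus)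
    show "subspace ?B" by (intro subspace_sum_subspaces finite_below F' pts)
    show "OI R F r \<inter> ?B \<subseteq> {0}" unfolding M by (rule orthogonal_complement_meets_trivially)
    show "OI R F r \<subseteq> span E" unfolding M using F'(2)[OF r] V(2) by (auto simp: ominus_def)
    have "?B \<subseteq> V" using F' pts V(1) by (intro sum_subspaces_least finite_below) auto
    then show "?B \<subseteq> span E" using V(2) by blast
  qed
  ultimately show ?thesis by (simp add: downward_transversal_def)
qed

text \<open>Both cumulative sums at \<open>s\<close> are known: the one of the pushforward is
  \<open>F (u s)\<close>, the one of \<open>OI S G\<close> is \<open>G s\<close>.\<close>

lemma pushforward_OI_moebius_equiv:
  assumes R: "finite_poset R" and F: "monotone_space_function V R F"
    and S: "finite_poset S" and G: "monotone_space_function V S G"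
    and V: "V \<subseteq> span E" "finite E"
    and gal: "galois_connection R S (l, u)" and FG: "\<forall>s\<in>pts S. F (u s) = G s"
  shows "moebius_equiv S (pushforward R S l (OI R F)) (OI S G)"
  unfolding moebius_equiv_def
proof
  fix s assume s: "s \<in> pts S"
  then have "u s \<in> pts R" by (rule galois_connection_mem[OF gal])
  then show "(\<Sum>s'\<in>below_eq S s. pushforward R S l (OI R F) s') = (\<Sum>s'\<in>below_eq S s. OI S G s')"
    using s FG
    by (simp add: cumulative_sum_pushforward[OF R S gal] cumulative_sum_OI[OF R F V]
        cumulative_sum_OI[OF S G V])
qed


section \<open>The two categories\<close>

lemma galois_connection_id: "galois_connection R R (galois_id R)"
  by (auto simp: galois_connection_def galois_id_def monotone_on_def)

lemma galois_connection_comp: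
  assumes f: "galois_connection R S f" and g: "galois_connection S T g"
  shows "galois_connection R T (galois_comp R T g f)"
proof -
  obtain l u k v where fg: "f = (l, u)" "g = (k, v)" by (cases f, cases g)
  note f = f[unfolded fg] and g = g[unfolded fg]
  note mem = galois_connection_mem[OF f] galois_connection_mem[OF g]
  have "compose (pts R) k l \<in> pts R \<rightarrow>\<^sub>E pts T" "compose (pts T) u v \<in> pts T \<rightarrow>\<^sub>E pts R"
    using mem by (auto simp: compose_def)
  moreover have "monotone_on (pts R) (le_in R) (le_in T) (compose (pts R) k l)"
    using galois_connectionD(3)[OF f] galois_connectionD(3)[OF g] mem
    by (simp add: monotone_on_def compose_def)
  moreover have "monotone_on (pts T) (le_in T) (le_in R) (compose (pts T) u v)"
    using galois_connectionD(4)[OF f] galois_connectionD(4)[OF g] mem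
    by (simp add: monotone_on_def compose_def)
  moreover have "le_in T (compose (pts R) k l r) t \<longleftrightarrow> le_in R r (compose (pts T) u v t)"
    if "r \<in> pts R" "t \<in> pts T" for r t
    using that mem galois_connectionD(5)[OF f, of r "v t"] galois_connectionD(5)[OF g, of "l r" t]
    by (simp add: compose_def)
  ultimately show ?thesis
    by (simp add: galois_connection_def galois_comp_def fg)
qed

lemma galois_comp_id:
  assumes "galois_connection R S f"
  shows "galois_comp R S f (galois_id R) = f" and "galois_comp R S (galois_id S) f = f"
proof -
  obtain l u where f: "f = (l, u)" by (cases f)
  note D = galois_connectionD(1,2)[OF assms[unfolded f]]
  have "l \<in> pts R \<rightarrow> pts S" "l \<in> extensional (pts R)" "u \<in> pts S \<rightarrow> pts R" "u \<in> extensional (pts S)"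
    using D by (auto simp: PiE_def)
  then show "galois_comp R S f (galois_id R) = f" and "galois_comp R S (galois_id S) f = f"
    by (simp_all add: f galois_comp_def galois_id_def Id_compose compose_Id id_def)
qed

lemma galois_comp_assoc:
  assumes "galois_connection R1 R2 f" and "galois_connection R2 R3 g" and "galois_connection R3 R4 h"
  shows "galois_comp R1 R4 h (galois_comp R1 R3 g f) = galois_comp R1 R4 (galois_comp R2 R4 h g) f"
proof -
  obtain l1 u1 l2 u2 l3 u3 where fgh: "f = (l1, u1)" "g = (l2, u2)" "h = (l3, u3)"
    by (cases f, cases g, cases h)
  have "l1 \<in> pts R1 \<rightarrow> pts R2" "u3 \<in> pts R4 \<rightarrow> pts R3"
    using galois_connectionD(1)[OF assms(1)[unfolded fgh]] galois_connectionD(2)[OF assms(3)[unfolded fgh]]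
    by (auto simp: PiE_def)
  then show ?thesis by (simp add: galois_comp_def fgh compose_assoc)
qed

text \<open>The unit and associativity laws hold already for Galois connections, whatever data the objects
  carry. What depends on the data is the closure of the hom sets under identities and composition.\<close>

lemma category_of_galois_connections:
  fixes C :: "('a mposet \<times> 'x, 'a galois) cost_cat"
  assumes hom: "\<And>R X S Y f. f \<in> hom C (R, X) (S, Y) \<Longrightarrow> galois_connection R S f"
    and ident: "\<And>R X. ident C (R, X) = galois_id R"
    and compos: "\<And>R X S Y T Z. compos C (R, X) (S, Y) (T, Z) = galois_comp R T"
    and id_hom: "\<And>R X. (R, X) \<in> obj C \<Longrightarrow> galois_id R \<in> hom C (R, X) (R, X)"
    and comp_hom: "\<And>R X S Y T Z f g.
      \<lbrakk>(R, X) \<in> obj C; (S, Y) \<in> obj C; (T, Z) \<in> obj C;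
       f \<in> hom C (R, X) (S, Y); g \<in> hom C (S, Y) (T, Z)\<rbrakk>
      \<Longrightarrow> galois_comp R T g f \<in> hom C (R, X) (T, Z)"
  shows "category C"
  unfolding category_def
proof (intro conjI ballI)
  fix A assume "A \<in> obj C"
  then show "ident C A \<in> hom C A A"
    using id_hom by (cases A) (simp add: ident)
next
  fix A1 A2 A3 f g
  assume "A1 \<in> obj C" "A2 \<in> obj C" "A3 \<in> obj C" "f \<in> hom C A1 A2" "g \<in> hom C A2 A3"
  then show "compos C A1 A2 A3 g f \<in> hom C A1 A3"
    using comp_hom by (cases A1, cases A2, cases A3) (simp add: compos)
next
  fix A B f assume "f \<in> hom C A B"
  then show "compos C A A B f (ident C A) = f" "compos C A B B (ident C B) f = f"
    by (cases A, cases B, simp add: compos ident galois_comp_id[OF hom])+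
next
  fix A1 A2 A3 A4 f g h
  assume "f \<in> hom C A1 A2" "g \<in> hom C A2 A3" "h \<in> hom C A3 A4"
  then show "compos C A1 A3 A4 h (compos C A1 A2 A3 g f)
      = compos C A1 A2 A4 (compos C A2 A3 A4 h g) f"
    by (cases A1, cases A2, cases A3, cases A4) (simp add: compos galois_comp_assoc[OF hom hom hom])
qed

lemma pullback_galois_comp:
  assumes "galois_connection R S (l, u)" and "galois_connection S T (k, v)"
    and "\<forall>s\<in>pts S. F (u s) = G s" and "\<forall>t\<in>pts T. G (v t) = H t"
  shows "\<forall>t\<in>pts T. F (compose (pts T) u v t) = H t"
  using assms(3,4) galois_connection_mem(2)[OF assms(2)] by (simp add: compose_eq)

lemma moebius_equiv_pushforward_id:
  assumes "finite_poset R"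
  shows "moebius_equiv R (pushforward R R (restrict id (pts R)) M) M"
  using cumulative_sum_pushforward[OF assms assms galois_connection_id[unfolded galois_id_def], of _ M]
  by (simp add: moebius_equiv_def)

text \<open>Replacing \<open>N\<close> by the Moebius equivalent pushforward of \<open>M\<close> changes the pushforward along \<open>k\<close>, but
  not its cumulative sums: these are cumulative sums of \<open>N\<close> at the points \<open>v t\<close>.\<close>

lemma moebius_equiv_pushforward_comp:
  assumes R: "finite_poset R" and S: "finite_poset S" and T: "finite_poset T"
    and f: "galois_connection R S (l, u)" and g: "galois_connection S T (k, v)"
    and MN: "moebius_equiv S (pushforward R S l M) N"
    and NK: "moebius_equiv T (pushforward S T k N) K"
  shows "moebius_equiv T (pushforward R T (compose (pts R) k l) M) K"
  unfolding moebius_equiv_def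
proof
  fix t assume t: "t \<in> pts T"
  have vt: "v t \<in> pts S" using galois_connection_mem(2)[OF g t] .
  have comp: "galois_connection R T (compose (pts R) k l, compose (pts T) u v)"
    using galois_connection_comp[OF f g] by (simp add: galois_comp_def)
  have "(\<Sum>t'\<in>below_eq T t. pushforward R T (compose (pts R) k l) M t')
      = (\<Sum>r\<in>below_eq R (u (v t)). M r)"
    using cumulative_sum_pushforward[OF R T comp t, of M] t by (simp add: compose_eq)
  also have "\<dots> = (\<Sum>s\<in>below_eq S (v t). pushforward R S l M s)"
    by (rule cumulative_sum_pushforward[OF R S f vt, symmetric])
  also have "\<dots> = (\<Sum>s\<in>below_eq S (v t). N s)"
    using MN vt by (simp add: moebius_equiv_def)
  also have "\<dots> = (\<Sum>t'\<in>below_eq T t. pushforward S T k N t')"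
    by (rule cumulative_sum_pushforward[OF S T g t, symmetric])
  also have "\<dots> = (\<Sum>t'\<in>below_eq T t. K t')"
    using NK t by (simp add: moebius_equiv_def)
  finally show "(\<Sum>t'\<in>below_eq T t. pushforward R T (compose (pts R) k l) M t')
      = (\<Sum>t'\<in>below_eq T t. K t')" .
qed

lemma category_Mon: "category (Mon V :: (('a, 'v::real_inner) space_fun, 'a galois) cost_cat)"
proof (rule category_of_galois_connections)
  fix R S T :: "'a mposet" and F G H :: "'a \<Rightarrow> 'v set" and f g :: "'a galois"
  show "galois_connection R S f" if "f \<in> hom (Mon V) (R, F) (S, G)"
    using that by (auto simp: Mon_def)
  show "ident (Mon V) (R, F) = galois_id R"
    and "compos (Mon V) (R, F) (S, G) (T, H) = galois_comp R T"
    by (simp_all add: Mon_def)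
  show "galois_id R \<in> hom (Mon V) (R, F) (R, F)"
    using galois_connection_id[of R] by (simp add: Mon_def galois_id_def)
  show "galois_comp R T g f \<in> hom (Mon V) (R, F) (T, H)"
    if "f \<in> hom (Mon V) (R, F) (S, G)" "g \<in> hom (Mon V) (S, G) (T, H)"
  proof -
    obtain l u k v where fg: "f = (l, u)" "g = (k, v)" by (cases f, cases g)
    have gal: "galois_connection R S (l, u)" "galois_connection S T (k, v)"
      and eq: "\<forall>s\<in>pts S. F (u s) = G s" "\<forall>t\<in>pts T. G (v t) = H t"
      using that by (simp_all add: Mon_def fg)
    then show ?thesis
      using galois_connection_comp[OF gal] pullback_galois_comp[OF gal eq]
      by (simp add: Mon_def fg galois_comp_def)
  qed
qed

lemma category_DT_Fnc:
  "category (DT_Fnc V :: (('a, 'v::real_inner) space_fun, 'a galois) cost_cat)"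
proof (rule category_of_galois_connections)
  fix R S T :: "'a mposet" and M N K :: "'a \<Rightarrow> 'v set" and f g :: "'a galois"
  have fin: "finite_poset P" if "(P, L) \<in> obj (DT_Fnc V)" for P and L :: "'a \<Rightarrow> 'v set"
    using that by (simp add: DT_Fnc_def finite_metric_poset_imp_finite_poset)
  show "galois_connection R S f" if "f \<in> hom (DT_Fnc V) (R, M) (S, N)"
    using that by (auto simp: DT_Fnc_def)
  show "ident (DT_Fnc V) (R, M) = galois_id R"
    and "compos (DT_Fnc V) (R, M) (S, N) (T, K) = galois_comp R T"
    by (simp_all add: DT_Fnc_def)
  show "galois_id R \<in> hom (DT_Fnc V) (R, M) (R, M)" if "(R, M) \<in> obj (DT_Fnc V)"
    using galois_connection_id[of R] moebius_equiv_pushforward_id[OF fin[OF that]]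
    by (simp add: DT_Fnc_def galois_id_def)
  show "galois_comp R T g f \<in> hom (DT_Fnc V) (R, M) (T, K)"
    if obj: "(R, M) \<in> obj (DT_Fnc V)" "(S, N) \<in> obj (DT_Fnc V)" "(T, K) \<in> obj (DT_Fnc V)"
      and homs: "f \<in> hom (DT_Fnc V) (R, M) (S, N)" "g \<in> hom (DT_Fnc V) (S, N) (T, K)"
  proof -
    obtain l u k v where fg: "f = (l, u)" "g = (k, v)" by (cases f, cases g)
    have gal: "galois_connection R S (l, u)" "galois_connection S T (k, v)"
      and eq: "moebius_equiv S (pushforward R S l M) N" "moebius_equiv T (pushforward S T k N) K"
      using homs by (simp_all add: DT_Fnc_def fg)
    show ?thesis
      using galois_connection_comp[OF gal]
        moebius_equiv_pushforward_comp[OF fin[OF obj(1)] fin[OF obj(2)] fin[OF obj(3)] gal eq]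
      by (simp add: DT_Fnc_def fg galois_comp_def)
  qed
qed


section \<open>The functor and the edit distance\<close>

lemma zigzag_functor:
  assumes is_functor: "is_functor C D Fo Fm"
    and cost: "\<And>A B f. A \<in> obj C \<Longrightarrow> B \<in> obj C \<Longrightarrow> f \<in> hom C A B
      \<Longrightarrow> cost D (Fo A) (Fo B) (Fm A B f) = cost C A B f"
    and zigzag: "zigzag C A B c"
  shows "zigzag D (Fo A) (Fo B) c"
  using zigzag
proof induction
  case (forward A B f)
  then have "zigzag D (Fo A) (Fo B) (cost D (Fo A) (Fo B) (Fm A B f))"
    using is_functor by (intro zigzag.forward) (auto simp: is_functor_def)
  then show ?case using forward by (simp add: cost)
next
  case (backward A B f)
  then have "zigzag D (Fo A) (Fo B) (cost D (Fo B) (Fo A) (Fm B A f))"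
    using is_functor by (intro zigzag.backward) (auto simp: is_functor_def)
  then show ?case using backward by (simp add: cost)
next
  case (concat A E c B c')
  then show ?case by (blast intro: zigzag.concat)
qed

text \<open>The right-hand infimum ranges over the costs of the paths in \<open>C\<close>; each of them is also the cost of a
  path in \<open>D\<close>, namely of the image path.\<close>

lemma edit_distance_functor_le:
  assumes "is_functor C D Fo Fm"
    and "\<And>A B f. A \<in> obj C \<Longrightarrow> B \<in> obj C \<Longrightarrow> f \<in> hom C A B
      \<Longrightarrow> cost D (Fo A) (Fo B) (Fm A B f) = cost C A B f"
  shows "edit_distance D (Fo A) (Fo B) \<le> edit_distance C A B"
  unfolding edit_distance_def
  by (rule Inf_superset_mono) (use zigzag_functor[OF assms] in blast)

lemma is_functor_OI:
  fixes V :: "'v::real_inner set"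
  assumes V: "subspace V" "V \<subseteq> span E" "finite E"
  shows "is_functor (Mon V :: (('a, 'v) space_fun, 'a galois) cost_cat) (DT_Fnc V)
           OI_obj (\<lambda>A B f. f)"
  unfolding is_functor_def
proof (intro conjI ballI category_Mon category_DT_Fnc)
  fix A :: "('a, 'v) space_fun"
  assume "A \<in> obj (Mon V)"
  then show "OI_obj A \<in> obj (DT_Fnc V)"
    by (auto simp: Mon_def DT_Fnc_def OI_obj_def
        intro!: downward_transversal_OI[OF _ _ V] finite_metric_poset_imp_finite_poset)
next
  fix A B :: "('a, 'v) space_fun" and f :: "'a galois"
  assume "A \<in> obj (Mon V)" "B \<in> obj (Mon V)" "f \<in> hom (Mon V) A B"
  then show "f \<in> hom (DT_Fnc V) (OI_obj A) (OI_obj B)"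
    by (cases A, cases B, cases f)
      (auto simp: Mon_def DT_Fnc_def OI_obj_def
        intro!: pushforward_OI_moebius_equiv[OF _ _ _ _ V(2,3)] finite_metric_poset_imp_finite_poset)
qed (auto simp: Mon_def DT_Fnc_def OI_obj_def)

theorem theorem3:
  fixes V :: "'v::real_inner set"
  assumes "subspace V" and "\<exists>B. finite B \<and> span B = V"
  shows "is_functor (Mon V :: (('a, 'v) space_fun, 'a galois) cost_cat) (DT_Fnc V)
           OI_obj (\<lambda>A B f. f)
       \<and> (\<forall>F \<in> obj (Mon V :: (('a, 'v) space_fun, 'a galois) cost_cat).
          \<forall>G \<in> obj (Mon V :: (('a, 'v) space_fun, 'a galois) cost_cat).
            edit_distance (DT_Fnc V) (OI_obj F) (OI_obj G) \<le> edit_distance (Mon V) F G)"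
proof -
  obtain E where "finite E" "V \<subseteq> span E" using assms(2) by blast
  then have "is_functor (Mon V :: (('a, 'v) space_fun, 'a galois) cost_cat) (DT_Fnc V)
      OI_obj (\<lambda>A B f. f)"
    using is_functor_OI assms(1) by blast
  moreover have "cost (DT_Fnc V) (OI_obj A) (OI_obj B) f = cost (Mon V) A B f"
    for A B :: "('a, 'v) space_fun" and f
    by (cases A, cases B) (simp add: Mon_def DT_Fnc_def OI_obj_def)
  ultimately show ?thesis by (intro conjI ballI edit_distance_functor_le) auto
qed

end
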